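(* Let $n,m,k$ be positive integers with $k\le n$ and $k\le m$. The number of standard Young tableaux of truncated straight shape $n^m\setminus(k^{k-1},k-1)$ is $$\binom{nm-k^2+1}{m(n-k)}\binom{k(m+n-2k)+1}{kn-k^2}^{-1}f_{(m^{n-k})}\,f_{((m-k)^{k})}.$$
   Context: For integer partitions $\lambda,\mu$ with $\lambda_i\ge\mu_i$ for all $i$ (with $\mu_i=0$ beyond the length of $\mu$), the straight diagram of truncated shape $\lambda\setminus\mu$ is the left-justified array of boxes whose row $i$ (counted from the top) has $\lambda_i-\mu_i$ boxes. The notation $a^b$ in a partition means that the part $a$ is repeated $b$ times. So $n^m\setminus(k^{k-1},k-1)$ has $m$ rows: the first $k-1$ rows have length $n-k$, the $k$-th row has length $n-k+1$, and the remaining rows have length $n$ (a rectangle truncated by a $k\times k$ square minus one box). A standard Young tableau of such a shape with $N$ boxes is a filling of the boxes with $1,\ldots,N$, each used exactly once, with entries increasing along rows and down columns. $f_\lambda$ denotes the number of standard Young tableaux of ordinary straight shape $\lambda$ (equal to $1$ for the empty shape). *)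

theory Defs
  imports Complex_Main "HOL-Library.FuncSet"
begin

text \<open>
  Partitions are weakly decreasing lists of naturals; trailing zero parts are allowed and do not
  affect any diagram. Rows and columns are counted from 0.
\<close>

definition part :: "nat list \<Rightarrow> nat \<Rightarrow> nat" where
  "part p i = (if i < length p then p ! i else 0)"

definition diagram :: "nat list \<Rightarrow> (nat \<times> nat) set" where
  "diagram p = {(i, j). j < part p i}"

text \<open>Intended for partitions with \<open>part q i \<le> part p i\<close> for all \<open>i\<close>.\<close>

definition truncated_diagram :: "nat list \<Rightarrow> nat list \<Rightarrow> (nat \<times> nat) set" where
  "truncated_diagram p q = {(i, j). j < part p i - part q i}"

text \<open>Fillings are \<open>undefined\<close> outside the diagram, so that each tableau is counted once.\<close>

definition standard_tableaux :: "(nat \<times> nat) set \<Rightarrow> (nat \<times> nat \<Rightarrow> nat) set" where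
  "standard_tableaux D = {T \<in> extensional D.
     bij_betw T D {1..card D} \<and>
     (\<forall>i j j'. (i, j) \<in> D \<and> (i, j') \<in> D \<and> j < j' \<longrightarrow> T (i, j) < T (i, j')) \<and>
     (\<forall>i i' j. (i, j) \<in> D \<and> (i', j) \<in> D \<and> i < i' \<longrightarrow> T (i, j) < T (i', j))}"

definition num_SYT :: "nat list \<Rightarrow> nat" where
  "num_SYT p = card (standard_tableaux (diagram p))"

definition num_truncated_SYT :: "nat list \<Rightarrow> nat list \<Rightarrow> nat" where
  "num_truncated_SYT p q = card (standard_tableaux (truncated_diagram p q))"

lemma num_SYT_empty: "diagram p = {} \<Longrightarrow> num_SYT p = 1"
  by (simp add: num_SYT_def standard_tableaux_def bij_betw_def Collect_conv_if)

lemma truncated_diagram_square_minus_box: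
  assumes "1 \<le> k" "k \<le> n" "k \<le> m"
  shows "truncated_diagram (replicate m n) (replicate (k - 1) k @ [k - 1]) =
    {(i, j). i < m \<and> j < (if i < k - 1 then n - k else if i = k - 1 then n - k + 1 else n)}"
  using assms
  by (auto simp: truncated_diagram_def part_def nth_append split: if_splits)

end

theory Submission
  imports Defs
begin

text \<open>
  Put \<open>a = m - k\<close> and \<open>b = n - k\<close>, and condition on the set of cells whose entries are smaller than
  the entry of the corner cell \<open>(k - 1, b)\<close>. This set is a \<open>k \<times> b\<close> rectangle with a partition \<open>J\<close> inside
  an \<open>a \<times> b\<close> box attached below it; rotated by a half turn, the set of cells with larger entries is
  the complement of \<open>J\<close> with \<open>k\<close> columns attached. By Frobenius' formula, attaching the \<open>k\<close> rows or
  columns multiplies the number of tableaux by \<open>\<Prod> l! / (l + k)!\<close> over the shifted parts, times a ratio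
  of factorials of the sizes. For \<open>J\<close> and its complement together the shifted parts are exactly
  \<open>0, \<dots>, a + b - 1\<close>, so the product does not depend on \<open>J\<close>. The sum over all \<open>J\<close> of a given size of the
  remaining product of tableau counts is the number of tableaux of the \<open>a \<times> b\<close> rectangle, and the sum
  over the sizes is a convolution of binomial coefficients.
\<close>

subsection \<open>Linear extensions\<close>

text \<open>The relation is arbitrary rather than a partial order, because \<open>cell_less\<close>
  below only relates cells in a common row or column and is not transitive.\<close>

definition linear_extensions :: "('a \<Rightarrow> 'a \<Rightarrow> bool) \<Rightarrow> 'a set \<Rightarrow> ('a \<Rightarrow> nat) set" where
  "linear_extensions R D = {T \<in> extensional D.
     bij_betw T D {1..card D} \<and> (\<forall>x\<in>D. \<forall>y\<in>D. R x y \<longrightarrow> T x < T y)}"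

definition num_ext :: "('a \<Rightarrow> 'a \<Rightarrow> bool) \<Rightarrow> 'a set \<Rightarrow> nat" where
  "num_ext R D = card (linear_extensions R D)"

definition maximal_in :: "('a \<Rightarrow> 'a \<Rightarrow> bool) \<Rightarrow> 'a set \<Rightarrow> 'a set" where
  "maximal_in R D = {c \<in> D. \<forall>x\<in>D. \<not> R c x}"

definition lower_in :: "('a \<Rightarrow> 'a \<Rightarrow> bool) \<Rightarrow> 'a set \<Rightarrow> 'a set \<Rightarrow> bool" where
  "lower_in R D I \<longleftrightarrow> I \<subseteq> D \<and> (\<forall>x\<in>I. \<forall>y\<in>D. R y x \<longrightarrow> y \<in> I)"

lemma num_ext_empty [simp]: "num_ext R {} = 1"
  by (simp add: num_ext_def linear_extensions_def bij_betw_def Collect_conv_if)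

lemma finite_linear_extensions: "finite D \<Longrightarrow> finite (linear_extensions R D)"
  by (rule finite_subset[OF _ finite_PiE[of D "\<lambda>_. {1..card D}"]])
    (auto simp: linear_extensions_def bij_betw_def PiE_def)

text \<open>Erasing the largest label is undone by writing \<open>card D\<close> back at
  \<open>c\<close>; nothing in \<open>D\<close> is required to exceed \<open>c\<close>, so this
  violates no constraint.\<close>

lemma bij_betw_top_linear_extensions:
  assumes "finite D" "c \<in> maximal_in R D"
  shows "bij_betw (\<lambda>T. restrict T (D - {c})) {T \<in> linear_extensions R D. T c = card D}
    (linear_extensions R (D - {c}))"
proof -
  have c: "c \<in> D" "\<And>x. x \<in> D \<Longrightarrow> \<not> R c x"
    using assms(2) by (auto simp: maximal_in_def)
  have pos: "card D > 0"
    using c(1) assms(1) card_gt_0_iff by blast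
  have iv: "{1..card D - 1} = {1..card D} - {card D}" "insert (card D) {1..card D - 1} = {1..card D}"
    using pos by auto
  show ?thesis
  proof (rule bij_betw_byWitness[where f' = "\<lambda>T. T(c := card D)"])
    show "\<forall>T\<in>{T \<in> linear_extensions R D. T c = card D}. (restrict T (D - {c}))(c := card D) = T"
      using c(1) by (auto simp: linear_extensions_def fun_eq_iff extensional_def)
    show "\<forall>T\<in>linear_extensions R (D - {c}). restrict (T(c := card D)) (D - {c}) = T"
      by (auto simp: linear_extensions_def fun_eq_iff extensional_def)
    show "(\<lambda>T. restrict T (D - {c})) ` {T \<in> linear_extensions R D. T c = card D}
      \<subseteq> linear_extensions R (D - {c})"
    proof clarify
      fix T assume T: "T \<in> linear_extensions R D" and Tc: "T c = card D"
      have bij: "bij_betw T (D - {c}) {1..card D - 1}"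
        unfolding iv(1)
      proof -
        have "inj_on T D" "T ` D = {1..card D}"
          using T by (auto simp: linear_extensions_def bij_betw_def)
        then show "bij_betw T (D - {c}) ({1..card D} - {card D})"
          using c(1) Tc inj_on_image_set_diff[of T D D "{c}"]
          by (auto simp: bij_betw_def intro: inj_on_subset)
      qed
      show "restrict T (D - {c}) \<in> linear_extensions R (D - {c})"
        using T bij c(1) assms(1) by (auto simp: linear_extensions_def card_Diff_singleton)
    qed
    show "(\<lambda>T. T(c := card D)) ` linear_extensions R (D - {c})
      \<subseteq> {T \<in> linear_extensions R D. T c = card D}"
    proof (rule image_subsetI)
      fix T assume T: "T \<in> linear_extensions R (D - {c})"
      have cd: "card (D - {c}) = card D - 1"
        using c(1) assms(1) by (simp add: card_Diff_singleton)
      have bij: "bij_betw T (D - {c}) {1..card D - 1}"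
        using T by (simp add: linear_extensions_def cd)
      have "bij_betw (T(c := card D)) (insert c (D - {c})) (insert (card D) {1..card D - 1})"
      proof -
        have "bij_betw (T(c := card D)) (D - {c}) {1..card D - 1}"
          using bij by (subst bij_betw_cong[of _ _ T]) auto
        then show ?thesis
          using pos notIn_Un_bij_betw[of c "D - {c}" "T(c := card D)" "{1..card D - 1}"]
          by auto
      qed
      then have bij': "bij_betw (T(c := card D)) D {1..card D}"
        using c(1) by (simp only: iv(2) insert_Diff)
      have less: "T x < card D" if "x \<in> D" "x \<noteq> c" for x
      proof -
        have "T x \<in> {1..card D - 1}"
          using bij_betwE[OF bij] that by blast
        then show ?thesis using pos by auto
      qed
      have "T(c := card D) \<in> linear_extensions R D"
        unfolding linear_extensions_def
        using T c less bij' by (auto simp: linear_extensions_def extensional_def)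
      then show "T(c := card D) \<in> {T \<in> linear_extensions R D. T c = card D}"
        by simp
    qed
  qed
qed

text \<open>The largest label always sits at a maximal element, so labellings are classified by its
  position. This recursion drives most of the inductions below.\<close>

lemma num_ext_remove_maximal:
  assumes "finite D" "D \<noteq> {}"
  shows "num_ext R D = (\<Sum>c\<in>maximal_in R D. num_ext R (D - {c}))"
proof -
  define S where "S c = {T \<in> linear_extensions R D. T c = card D}" for c
  have "linear_extensions R D = (\<Union>c\<in>maximal_in R D. S c)"
  proof (intro equalityI subsetI)
    fix T assume T: "T \<in> linear_extensions R D"
    then have img: "T ` D = {1..card D}"
      by (simp add: linear_extensions_def bij_betw_def)
    have "card D \<in> {1..card D}"
      using assms by (simp add: Suc_le_eq card_gt_0_iff)
    then obtain c where c: "c \<in> D" "T c = card D"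
      using img by (metis imageE)
    have "\<not> R c x" if "x \<in> D" for x
    proof
      assume "R c x"
      then have "card D < T x"
        using T c that by (auto simp: linear_extensions_def)
      moreover have "T x \<in> {1..card D}"
        using img that by blast
      ultimately show False by simp
    qed
    then show "T \<in> (\<Union>c\<in>maximal_in R D. S c)"
      using T c by (auto simp: S_def maximal_in_def)
  qed (auto simp: S_def)
  moreover have "card (\<Union>c\<in>maximal_in R D. S c) = (\<Sum>c\<in>maximal_in R D. card (S c))"
  proof (rule card_UN_disjoint)
    show "finite (maximal_in R D)"
      using assms(1) by (simp add: maximal_in_def)
    show "\<forall>c\<in>maximal_in R D. finite (S c)"
      using finite_linear_extensions[OF assms(1)] by (simp add: S_def)
    show "\<forall>c\<in>maximal_in R D. \<forall>d\<in>maximal_in R D. c \<noteq> d \<longrightarrow> S c \<inter> S d = {}"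
      by (auto simp: S_def maximal_in_def linear_extensions_def bij_betw_def inj_on_def)
  qed
  moreover have "card (S c) = num_ext R (D - {c})" if "c \<in> maximal_in R D" for c
    using bij_betw_same_card[OF bij_betw_top_linear_extensions[OF assms(1) that]]
    by (simp add: S_def num_ext_def)
  ultimately show ?thesis
    by (simp add: num_ext_def)
qed

section \<open>Splitting a labelling at a lower set\<close>

lemma maximal_in_diff_lower:
  assumes "lower_in R D I"
  shows "maximal_in R (D - I) = maximal_in R D - I"
  using assms by (auto simp: maximal_in_def lower_in_def)

lemma lower_in_diff_maximal:
  assumes "c \<in> maximal_in R D"
  shows "lower_in R (D - {c}) I \<longleftrightarrow> lower_in R D I \<and> c \<notin> I"
  using assms by (auto simp: maximal_in_def lower_in_def)

lemma finite_lower_in: "finite D \<Longrightarrow> finite {I. lower_in R D I \<and> P I}"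
  by (rule finite_subset[of _ "Pow D"]) (auto simp: lower_in_def)

text \<open>The elements labelled \<open>1, ..., r\<close> form a lower set \<open>I\<close>, and
  \<open>I\<close> and \<open>D - I\<close> are labelled independently. The induction deletes the
  element with the largest label, which lies outside \<open>I\<close> unless \<open>I = D\<close>,
  and exchanges two summations.\<close>

lemma num_ext_split:
  assumes "finite D" "r \<le> card D"
  shows "num_ext R D = (\<Sum>I | lower_in R D I \<and> card I = r. num_ext R I * num_ext R (D - I))"
  using assms
proof (induction "card D" arbitrary: D)
  case 0
  then have "{I. lower_in R D I \<and> card I = r} = {{}}"
    by (auto simp: lower_in_def)
  then show ?case using 0 by simp
next
  case (Suc s)
  show ?case
  proof (cases "r = card D")
    case True
    then have "{I. lower_in R D I \<and> card I = r} = {D}"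
      using Suc.prems card_subset_eq[of D] by (auto simp: lower_in_def)
    then show ?thesis by simp
  next
    case False
    let ?M = "maximal_in R D"
    let ?L = "{I. lower_in R D I \<and> card I = r}"
    have fin: "finite ?M" "finite ?L"
      using Suc.prems finite_lower_in[of D R "\<lambda>I. card I = r"] by (auto simp: maximal_in_def)
    have cM: "card (D - {c}) = s" if "c \<in> ?M" for c
      using that Suc.prems Suc.hyps(2) by (auto simp: maximal_in_def)
    have "num_ext R D = (\<Sum>c\<in>?M. num_ext R (D - {c}))"
      using Suc by (intro num_ext_remove_maximal) auto
    also have "\<dots> = (\<Sum>c\<in>?M. \<Sum>I | I \<in> ?L \<and> c \<notin> I. num_ext R I * num_ext R (D - {c} - I))"
    proof (rule sum.cong)
      fix c assume c: "c \<in> ?M"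
      have "num_ext R (D - {c}) = (\<Sum>I | lower_in R (D - {c}) I \<and> card I = r.
          num_ext R I * num_ext R (D - {c} - I))"
        using cM[OF c] Suc.prems Suc.hyps(2) False by (intro Suc.hyps(1)) auto
      then show "num_ext R (D - {c}) =
          (\<Sum>I | I \<in> ?L \<and> c \<notin> I. num_ext R I * num_ext R (D - {c} - I))"
        by (simp add: lower_in_diff_maximal[OF c] conj_ac)
    qed simp
    also have "\<dots> = (\<Sum>I\<in>?L. \<Sum>c | c \<in> ?M \<and> c \<notin> I. num_ext R I * num_ext R (D - {c} - I))"
      by (rule sum.swap_restrict[OF fin])
    also have "\<dots> = (\<Sum>I\<in>?L. num_ext R I * num_ext R (D - I))"
    proof (rule sum.cong)
      fix I assume I: "I \<in> ?L"
      then have "D - I \<noteq> {}"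
        using False by (auto simp: lower_in_def)
      then have "num_ext R (D - I) = (\<Sum>c\<in>?M - I. num_ext R (D - I - {c}))"
        using I Suc.prems by (subst num_ext_remove_maximal) (auto simp: maximal_in_diff_lower)
      moreover have "D - {c} - I = D - I - {c}" for c by auto
      ultimately show "(\<Sum>c | c \<in> ?M \<and> c \<notin> I. num_ext R I * num_ext R (D - {c} - I)) =
          num_ext R I * num_ext R (D - I)"
        by (simp add: sum_distrib_left set_diff_eq)
    qed simp
    finally show ?thesis .
  qed
qed

text \<open>Here \<open>I\<close> is the set of elements with a smaller label than \<open>c\<close>.
  Again the element with the largest label is deleted; it is either \<open>c\<close> itself or an
  element outside \<open>insert c I\<close>.\<close>

lemma num_ext_pivot:
  assumes "finite D" "c \<in> D" and irrefl: "\<And>x. \<not> R x x"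
  shows "num_ext R D = (\<Sum>I | lower_in R D I \<and> c \<notin> I \<and> lower_in R D (insert c I).
    num_ext R I * num_ext R (D - insert c I))"
  using assms(1,2)
proof (induction "card D" arbitrary: D)
  case 0
  then show ?case by auto
next
  case (Suc s)
  let ?M = "maximal_in R D"
  let ?P = "\<lambda>D I. lower_in R D I \<and> c \<notin> I \<and> lower_in R D (insert c I)"
  have fin: "finite ?M" "finite {I. ?P D I}"
    using Suc.prems finite_lower_in[of D R "\<lambda>I. c \<notin> I \<and> lower_in R D (insert c I)"]
    by (auto simp: maximal_in_def)
  \<comment> \<open>The extra summand belongs to \<open>I = D - {c}\<close>, where \<open>c\<close>
    carries the largest label: then \<open>D - insert c I\<close> is empty and the removal recursion
    does not apply.\<close>
  have rest: "num_ext R (D - insert c I) =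
      (\<Sum>d | d \<in> ?M - {c} \<and> d \<notin> I. num_ext R (D - {d} - insert c I)) +
      (if I = D - {c} then 1 else 0)" if "?P D I" for I
  proof (cases "I = D - {c}")
    case True
    then have "{d. d \<in> ?M - {c} \<and> d \<notin> I} = {}" "D - insert c I = {}"
      by (auto simp: maximal_in_def)
    then show ?thesis using True by (simp only:) simp
  next
    case False
    then have "D - insert c I \<noteq> {}"
      using that Suc.prems by (auto simp: lower_in_def)
    then have "num_ext R (D - insert c I) =
        (\<Sum>d\<in>?M - insert c I. num_ext R (D - insert c I - {d}))"
      using Suc.prems that by (subst num_ext_remove_maximal) (auto simp: maximal_in_diff_lower)
    moreover have "D - {d} - insert c I = D - insert c I - {d}" for d by auto
    moreover have "{d. d \<in> ?M - {c} \<and> d \<notin> I} = ?M - insert c I" by auto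
    ultimately show ?thesis using False by simp
  qed
  have top: "?P D (D - {c}) \<longleftrightarrow> c \<in> ?M"
    using Suc.prems irrefl unfolding lower_in_def maximal_in_def by blast
  have "(\<Sum>I | ?P D I. num_ext R I * num_ext R (D - insert c I)) =
      (\<Sum>I | ?P D I. \<Sum>d | d \<in> ?M - {c} \<and> d \<notin> I.
         num_ext R I * num_ext R (D - {d} - insert c I)) +
      (\<Sum>I | ?P D I. if I = D - {c} then num_ext R I else 0)"
  proof -
    have "num_ext R I * num_ext R (D - insert c I) =
        (\<Sum>d | d \<in> ?M - {c} \<and> d \<notin> I. num_ext R I * num_ext R (D - {d} - insert c I)) +
        (if I = D - {c} then num_ext R I else 0)" if "?P D I" for I
      unfolding rest[OF that] distrib_left sum_distrib_left by simp
    then show ?thesis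
      unfolding sum.distrib[symmetric] by (intro sum.cong refl) blast
  qed
  also have "(\<Sum>I | ?P D I. if I = D - {c} then num_ext R I else 0) =
      (if c \<in> ?M then num_ext R (D - {c}) else 0)"
    using fin(2) top by (auto simp: sum.delta maximal_in_def)
  also have "(\<Sum>I | ?P D I. \<Sum>d | d \<in> ?M - {c} \<and> d \<notin> I.
         num_ext R I * num_ext R (D - {d} - insert c I)) =
      (\<Sum>d\<in>?M - {c}. \<Sum>I | I \<in> {I. ?P D I} \<and> d \<notin> I.
         num_ext R I * num_ext R (D - {d} - insert c I))"
    using fin sum.swap_restrict[of "{I. ?P D I}" "?M - {c}"
        "\<lambda>I d. num_ext R I * num_ext R (D - {d} - insert c I)" "\<lambda>I d. d \<notin> I"]
    by simp
  also have "\<dots> = (\<Sum>d\<in>?M - {c}. num_ext R (D - {d}))"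
  proof (rule sum.cong)
    fix d assume d: "d \<in> ?M - {c}"
    have "num_ext R (D - {d}) = (\<Sum>I | ?P (D - {d}) I. num_ext R I * num_ext R (D - {d} - insert c I))"
      using d Suc.prems Suc.hyps(2) by (intro Suc.hyps(1)) (auto simp: maximal_in_def)
    moreover have "{I. ?P (D - {d}) I} = {I. I \<in> {I. ?P D I} \<and> d \<notin> I}"
      using d by (auto simp: lower_in_diff_maximal)
    ultimately show "(\<Sum>I | I \<in> {I. ?P D I} \<and> d \<notin> I.
        num_ext R I * num_ext R (D - {d} - insert c I)) = num_ext R (D - {d})"
      by simp
  qed simp
  also have "\<dots> + (if c \<in> ?M then num_ext R (D - {c}) else 0) = (\<Sum>d\<in>?M. num_ext R (D - {d}))"
    using fin(1) by (auto simp: sum.remove)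
  also have "\<dots> = num_ext R D"
    using Suc.prems by (intro num_ext_remove_maximal[symmetric]) auto
  finally show ?case by simp
qed

text \<open>Case \<open>r = 1\<close> of \<open>num_ext_split\<close>: the lower sets with one
  element are the minimal elements, which are the maximal ones for the reversed relation.\<close>

lemma num_ext_remove_minimal:
  assumes "finite D" "D \<noteq> {}" "\<And>x. \<not> R x x"
  shows "num_ext R D = (\<Sum>c\<in>maximal_in (\<lambda>x y. R y x) D. num_ext R (D - {c}))"
proof -
  have one: "num_ext R {c} = 1" for c
    using assms(3) by (subst num_ext_remove_maximal) (auto simp: maximal_in_def Collect_conv_if)
  have "{I. lower_in R D I \<and> card I = 1} = (\<lambda>c. {c}) ` maximal_in (\<lambda>x y. R y x) D"
  proof (intro equalityI subsetI)
    fix I assume "I \<in> {I. lower_in R D I \<and> card I = 1}"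
    then obtain c where c: "I = {c}" and low: "lower_in R D {c}"
      by (auto simp: card_1_singleton_iff)
    then have "c \<in> maximal_in (\<lambda>x y. R y x) D"
      using assms(3) unfolding lower_in_def maximal_in_def by blast
    then show "I \<in> (\<lambda>c. {c}) ` maximal_in (\<lambda>x y. R y x) D"
      using c by blast
  qed (auto simp: lower_in_def maximal_in_def)
  moreover have "1 \<le> card D"
    using assms by (simp add: Suc_le_eq card_gt_0_iff)
  ultimately show ?thesis
    using assms(1) by (subst num_ext_split[where r = 1]) (auto simp: sum.reindex one)
qed

text \<open>Both sides obey the same recursion, since removing a maximal element for the reversed
  relation is removing a minimal one for \<open>R\<close>. This serves the half turn of
  diagrams.\<close>

lemma num_ext_reverse:
  assumes "finite D" "\<And>x. \<not> R x x"
  shows "num_ext (\<lambda>x y. R y x) D = num_ext R D"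
  using assms(1)
proof (induction "card D" arbitrary: D)
  case (Suc s)
  then have "D \<noteq> {}" by auto
  then have "num_ext (\<lambda>x y. R y x) D =
      (\<Sum>c\<in>maximal_in (\<lambda>x y. R y x) D. num_ext (\<lambda>x y. R y x) (D - {c}))"
    using Suc.prems by (intro num_ext_remove_maximal)
  also have "\<dots> = (\<Sum>c\<in>maximal_in (\<lambda>x y. R y x) D. num_ext R (D - {c}))"
    using Suc by (intro sum.cong refl Suc.hyps(1)) (auto simp: maximal_in_def)
  also have "\<dots> = num_ext R D"
    using Suc.prems \<open>D \<noteq> {}\<close> assms(2) by (intro num_ext_remove_minimal[symmetric])
  finally show ?case .
qed simp

lemma num_ext_image:
  assumes "finite D" "inj_on f D" "\<And>x y. x \<in> D \<Longrightarrow> y \<in> D \<Longrightarrow> S (f x) (f y) \<longleftrightarrow> R x y"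
  shows "num_ext S (f ` D) = num_ext R D"
  using assms
proof (induction "card D" arbitrary: D)
  case (Suc s)
  then have ne: "D \<noteq> {}" by auto
  have "maximal_in S (f ` D) = f ` maximal_in R D"
    using Suc.prems by (auto simp: maximal_in_def)
  then have "num_ext S (f ` D) = (\<Sum>c\<in>f ` maximal_in R D. num_ext S (f ` D - {c}))"
    using Suc.prems ne by (subst num_ext_remove_maximal) auto
  also have "\<dots> = (\<Sum>c\<in>maximal_in R D. num_ext S (f ` D - {f c}))"
    using Suc.prems(2) by (subst sum.reindex) (auto simp: maximal_in_def intro: inj_on_subset)
  also have "\<dots> = (\<Sum>c\<in>maximal_in R D. num_ext R (D - {c}))"
  proof (rule sum.cong)
    fix c assume c: "c \<in> maximal_in R D"
    then have "f ` D - {f c} = f ` (D - {c})"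
      using inj_on_image_set_diff[OF Suc.prems(2), of D "{c}"] by (auto simp: maximal_in_def)
    moreover have "num_ext S (f ` (D - {c})) = num_ext R (D - {c})"
      using Suc.prems c Suc.hyps(2)
      by (intro Suc.hyps(1)) (auto simp: maximal_in_def intro: inj_on_subset)
    ultimately show "num_ext S (f ` D - {f c}) = num_ext R (D - {c})" by simp
  qed simp
  also have "\<dots> = num_ext R D"
    using Suc.prems ne by (intro num_ext_remove_maximal[symmetric])
  finally show ?case .
qed simp

subsection \<open>Rational function and binomial identities\<close>

text \<open>Partial fraction expansion in \<open>y\<close> of a rational function with simple poles
  at the \<open>x i\<close>. The induction hypothesis is used twice, at \<open>y\<close> and at the
  new pole \<open>x t\<close>.\<close>

lemma prod_one_minus_inverse_diff:
  fixes x :: "'i \<Rightarrow> 'a::field"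
  assumes "finite I" "inj_on x I" "y \<notin> x ` I"
  shows "(\<Prod>j\<in>I. 1 - 1 / (y - x j)) =
    1 - (\<Sum>i\<in>I. (\<Prod>j\<in>I - {i}. 1 - 1 / (x i - x j)) / (y - x i))"
  using assms
proof (induction I arbitrary: y rule: finite_induct)
  case (insert t I)
  define A where "A i = (\<Prod>j\<in>I - {i}. 1 - 1 / (x i - x j))" for i
  have inj: "inj_on x I" and nt: "x t \<notin> x ` I" and ny: "y \<notin> x ` I" "y \<noteq> x t"
    using insert by (auto simp: inj_on_def)
  have ins: "(\<Prod>j\<in>insert t I - {i}. 1 - 1 / (x i - x j)) = A i * (1 - 1 / (x i - x t))" if "i \<in> I" for i
  proof -
    have "insert t I - {i} = insert t (I - {i})" "t \<notin> I - {i}"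
      using insert that by auto
    then show ?thesis using insert(1) by (simp add: A_def mult.commute)
  qed
  have "insert t I - {t} = I" using insert by auto
  then have "(\<Sum>i\<in>insert t I. (\<Prod>j\<in>insert t I - {i}. 1 - 1 / (x i - x j)) / (y - x i)) =
      (\<Prod>j\<in>I. 1 - 1 / (x t - x j)) / (y - x t) + (\<Sum>i\<in>I. A i * (1 - 1 / (x i - x t)) / (y - x i))"
    using insert(1,2) by (simp add: ins cong: sum.cong)
  also have "\<dots> = (1 - (\<Sum>i\<in>I. A i / (x t - x i))) / (y - x t) +
      (\<Sum>i\<in>I. A i * (1 - 1 / (x i - x t)) / (y - x i))"
    using insert.IH[OF inj nt] by (simp add: A_def)
  also have "\<dots> = 1 / (y - x t) +
      (\<Sum>i\<in>I. A i * (1 - 1 / (x i - x t)) / (y - x i) - A i / (x t - x i) / (y - x t))"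
    by (simp add: diff_divide_distrib sum_divide_distrib sum_subtractf)
  \<comment> \<open>The denominators \<open>x i - x t\<close> cancel between the two fractions, and
    the common factor \<open>1 - 1 / (y - x t)\<close> appears.\<close>
  also have "\<dots> = 1 / (y - x t) + (\<Sum>i\<in>I. A i / (y - x i) * (1 - 1 / (y - x t)))"
  proof -
    have "A i * (1 - 1 / (x i - x t)) / (y - x i) - A i / (x t - x i) / (y - x t) =
        A i / (y - x i) * (1 - 1 / (y - x t))" if "i \<in> I" for i
    proof -
      have "x i \<noteq> x t" "y \<noteq> x i"
        using that nt ny by (metis imageI)+
      then have "x i - x t \<noteq> 0" "x t - x i \<noteq> 0" "y - x i \<noteq> 0" "y - x t \<noteq> 0"
        using ny by auto
      then show ?thesis
        by (simp add: divide_simps) (simp add: algebra_simps)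
    qed
    then show ?thesis by simp
  qed
  also have "\<dots> = 1 / (y - x t) + (\<Sum>i\<in>I. A i / (y - x i)) * (1 - 1 / (y - x t))"
    by (simp only: sum_distrib_right)
  finally have sum: "(\<Sum>i\<in>insert t I. (\<Prod>j\<in>insert t I - {i}. 1 - 1 / (x i - x j)) / (y - x i)) =
    1 / (y - x t) + (\<Sum>i\<in>I. A i / (y - x i)) * (1 - 1 / (y - x t))" .
  have prod: "(\<Prod>j\<in>I. 1 - 1 / (y - x j)) = 1 - (\<Sum>i\<in>I. A i / (y - x i))"
    unfolding A_def by (rule insert.IH[OF inj ny(1)])
  show ?case
    unfolding sum prod.insert[OF insert(1,2)] prod by (simp add: algebra_simps)
qed simp

text \<open>Up to sign, these are the coefficients of \<open>1/y\<close> and \<open>1/y^2\<close> in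
  the preceding expansion for large \<open>y\<close>. Both are proved together by induction, with
  that expansion at \<open>y = x t\<close> giving the term of the new index. The second one drives
  Frobenius' formula.\<close>

lemma sum_prod_one_minus_inverse_diff:
  fixes x :: "'i \<Rightarrow> 'a::field"
  assumes "finite I" "inj_on x I"
  shows "(\<Sum>i\<in>I. \<Prod>j\<in>I - {i}. 1 - 1 / (x i - x j)) = of_nat (card I) \<and>
    (\<Sum>i\<in>I. x i * (\<Prod>j\<in>I - {i}. 1 - 1 / (x i - x j))) = (\<Sum>i\<in>I. x i) - of_nat (card I choose 2)"
  using assms
proof (induction I rule: finite_induct)
  case (insert t I)
  define A where "A i = (\<Prod>j\<in>I - {i}. 1 - 1 / (x i - x j))" for i
  have inj: "inj_on x I" and nt: "x t \<notin> x ` I"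
    using insert by (auto simp: inj_on_def)
  have ins: "(\<Prod>j\<in>insert t I - {i}. 1 - 1 / (x i - x j)) = A i + A i / (x t - x i)" if "i \<in> I" for i
  proof -
    have "insert t I - {i} = insert t (I - {i})" "t \<notin> I - {i}"
      using insert that by auto
    moreover have "x i - x t \<noteq> 0" "x t - x i \<noteq> 0"
      using nt that by (metis imageI eq_iff_diff_eq_0)+
    ultimately show ?thesis using insert(1) 
      by (simp add: A_def[symmetric]) (simp add: divide_simps, simp add: algebra_simps)
  qed
  have xA: "x i * (A i + A i / (x t - x i)) = x i * A i - A i + x t * (A i / (x t - x i))" if "i \<in> I" for i
  proof -
    have "x t - x i \<noteq> 0"
      using nt that by (metis imageI eq_iff_diff_eq_0)
    then show ?thesis by (simp add: divide_simps) (simp add: algebra_simps)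
  qed
  have It: "insert t I - {t} = I" using insert by auto
  have IH: "(\<Sum>i\<in>I. A i) = of_nat (card I)" "(\<Sum>i\<in>I. x i * A i) = (\<Sum>i\<in>I. x i) - of_nat (card I choose 2)"
    using insert.IH[OF inj] by (auto simp: A_def)
  have P: "(\<Prod>j\<in>I. 1 - 1 / (x t - x j)) = 1 - (\<Sum>i\<in>I. A i / (x t - x i))"
    unfolding A_def by (rule prod_one_minus_inverse_diff[OF insert(1) inj nt])
  have "(\<Sum>i\<in>insert t I. \<Prod>j\<in>insert t I - {i}. 1 - 1 / (x i - x j)) = of_nat (card (insert t I))"
    using insert(1,2) by (simp add: It P ins sum.distrib IH cong: sum.cong)
  moreover have "(\<Sum>i\<in>insert t I. x i * (\<Prod>j\<in>insert t I - {i}. 1 - 1 / (x i - x j))) =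
      (\<Sum>i\<in>insert t I. x i) - of_nat (card (insert t I) choose 2)"
  proof -
    have "(\<Sum>i\<in>insert t I. x i * (\<Prod>j\<in>insert t I - {i}. 1 - 1 / (x i - x j))) =
        x t * (1 - (\<Sum>i\<in>I. A i / (x t - x i))) +
        (\<Sum>i\<in>I. x i * A i - A i + x t * (A i / (x t - x i)))"
      unfolding sum.insert[OF insert(1,2)] It P
      by (intro arg_cong2[where f = "(+)"] sum.cong refl) (simp only: ins xA)
    also have "\<dots> = x t + (\<Sum>i\<in>I. x i * A i) - (\<Sum>i\<in>I. A i)"
      by (simp only: sum.distrib sum_subtractf sum_distrib_left[symmetric]) (simp add: algebra_simps)
    finally show ?thesis
      using insert(1,2) by (simp add: IH numeral_2_eq_2)
  qed
  ultimately show ?case by blast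
qed (simp add: binomial_eq_0)

text \<open>Coefficient of \<open>z^s\<close> in the product of the powers of \<open>1 - z\<close>
  with exponents \<open>-(p + 1)\<close> and \<open>-(q + 1)\<close>. The induction is on
  \<open>s\<close>, then on \<open>p\<close>; for \<open>p = 0\<close> the first factor is 1 and a
  hockey-stick sum remains.\<close>

lemma sum_choose_mult_choose:
  "(\<Sum>r\<le>s. ((p + r) choose r) * ((q + (s - r)) choose (s - r))) = (p + q + s + 1) choose s"
proof (induction s arbitrary: p)
  case (Suc s)
  note IH = Suc.IH
  show ?case
  proof (induction p)
    case 0
    have "(\<Sum>r\<le>Suc s. (q + (Suc s - r)) choose (Suc s - r)) = (\<Sum>r\<le>Suc s. (q + r) choose r)"
      by (rule sum.reindex_bij_witness[of _ "\<lambda>r. Suc s - r" "\<lambda>r. Suc s - r"]) auto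
    then show ?case by (simp add: sum_choose_lower del: sum.atMost_Suc)
  next
    case (Suc p)
    \<comment> \<open>Pascal's rule; \<open>r = 0\<close> is separated because \<open>r - 1\<close>
      is truncated. After an index shift the second sum is the outer hypothesis for
      \<open>Suc p\<close>.\<close>
    have "((Suc p + r) choose r) * X = ((p + r) choose r) * X + (if r = 0 then 0 else ((p + r) choose (r - 1)) * X)" for r X
      by (cases r) (auto simp: algebra_simps)
    then have "(\<Sum>r\<le>Suc s. ((Suc p + r) choose r) * ((q + (Suc s - r)) choose (Suc s - r))) = 
      (\<Sum>r\<le>Suc s. ((p + r) choose r) * ((q + (Suc s - r)) choose (Suc s - r))) +
      (\<Sum>r\<le>Suc s. (if r = 0 then 0 else ((p + r) choose (r - 1)) * ((q + (Suc s - r)) choose (Suc s - r))))"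
      by (simp only: sum.distrib)
    also have "(\<Sum>r\<le>Suc s. (if r = 0 then 0 else ((p + r) choose (r - 1)) * ((q + (Suc s - r)) choose (Suc s - r))))
      = (\<Sum>r\<le>s. ((Suc p + r) choose r) * ((q + (s - r)) choose (s - r)))"
      by (subst sum.atMost_Suc_shift) simp
    finally show ?case
      using Suc.IH IH[of "Suc p"] by (simp add: algebra_simps)
  qed
qed simp

subsection \<open>Tableaux of partition shape\<close>

definition cell_less :: "nat \<times> nat \<Rightarrow> nat \<times> nat \<Rightarrow> bool" where
  "cell_less x y \<longleftrightarrow> fst x = fst y \<and> snd x < snd y \<or> snd x = snd y \<and> fst x < fst y"

abbreviation syt :: "(nat \<times> nat) set \<Rightarrow> nat" where
  "syt \<equiv> num_ext cell_less"

lemma cell_less_irrefl: "\<not> cell_less x x"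
  by (simp add: cell_less_def)

lemma card_standard_tableaux: "card (standard_tableaux D) = syt D"
  unfolding num_ext_def standard_tableaux_def linear_extensions_def cell_less_def
  by (rule arg_cong[where f = card]) auto

text \<open>Row lengths are a function rather than a list, so that removing a cell is a function
  update; only the values below \<open>a\<close> matter.\<close>

definition shape :: "nat \<Rightarrow> (nat \<Rightarrow> nat) \<Rightarrow> (nat \<times> nat) set" where
  "shape a p = {(i, j). i < a \<and> j < p i}"

lemma shape_eq_Sigma: "shape a p = (SIGMA i:{..<a}. {..<p i})"
  by (auto simp: shape_def)

lemma finite_shape [simp]: "finite (shape a p)"
  by (simp add: shape_eq_Sigma)

lemma card_shape: "card (shape a p) = (\<Sum>i<a. p i)"
  by (simp add: shape_eq_Sigma)

text \<open>The beta numbers of a partition with \<open>a\<close> parts, zeros included; they are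
  the first-column hook lengths when all parts are positive.\<close>

definition shifted_part :: "nat \<Rightarrow> (nat \<Rightarrow> nat) \<Rightarrow> nat \<Rightarrow> nat" where
  "shifted_part a p i = p i + (a - 1 - i)"

definition diff_prod :: "nat \<Rightarrow> (nat \<Rightarrow> real) \<Rightarrow> real" where
  "diff_prod a x = (\<Prod>(i, j)\<in>{(i, j). i < j \<and> j < a}. x i - x j)"

lemma sum_lessThan_choose: "(\<Sum>t<a. t) = a choose 2"
  by (induction a) (simp_all add: numeral_2_eq_2)

lemma finite_pairs [simp]: "finite {(i, j). i < j \<and> j < (a::nat)}"
  by (rule finite_subset[of _ "{..<a} \<times> {..<a}"]) auto

text \<open>Every changed factor, whichever of its two indices is \<open>t\<close>, is multiplied by
  \<open>1 - 1 / (x t - x j)\<close> with \<open>j\<close> the other index.\<close>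

lemma diff_prod_decrease:
  assumes "t < a" "inj_on x {..<a}"
  shows "diff_prod a (x(t := x t - 1)) = diff_prod a x * (\<Prod>j\<in>{..<a} - {t}. 1 - 1 / (x t - x j))"
proof -
  let ?P = "{(i, j). i < j \<and> j < a}"
  \<comment> \<open>\<open>h\<close> is the quotient of the new and the old factor of each
    pair.\<close>
  define h where "h = (\<lambda>(i, j). if i = t then 1 - 1 / (x t - x j) else if j = t then 1 - 1 / (x t - x i) else 1)"
  have "diff_prod a (x(t := x t - 1)) = (\<Prod>q\<in>?P. (case q of (i, j) \<Rightarrow> x i - x j) * h q)"
    unfolding diff_prod_def
  proof (rule prod.cong, goal_cases)
    case (2 q)
    obtain i j where q: "q = (i, j)" "i < j" "j < a" using 2 by auto
    then have "x i - x j \<noteq> 0" "x j - x i \<noteq> 0"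
      using inj_onD[OF assms(2), of i j] by auto
    then have "x i - 1 - x j = (x i - x j) * (1 - 1 / (x i - x j))"
        "x i - (x j - 1) = (x i - x j) * (1 - 1 / (x j - x i))"
      by (simp_all add: divide_simps) (simp_all add: algebra_simps)
    then show ?case
      using q by (auto simp: h_def)
  qed simp
  also have "\<dots> = diff_prod a x * (\<Prod>q\<in>?P. h q)"
    by (simp add: prod.distrib diff_prod_def)
  also have "(\<Prod>q\<in>?P. h q) = (\<Prod>q\<in>{q \<in> ?P. fst q = t \<or> snd q = t}. h q)"
    by (rule prod.mono_neutral_right) (auto simp: h_def split: if_splits)
  also have "\<dots> = (\<Prod>j\<in>{..<a} - {t}. 1 - 1 / (x t - x j))"
    by (rule prod.reindex_bij_witness[of _ "\<lambda>s. if s < t then (s, t) else (t, s)"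
          "\<lambda>q. if fst q = t then snd q else fst q"])
      (use assms(1) in \<open>auto simp: h_def\<close>)
  finally show ?thesis .
qed

text \<open>Frobenius' expression for the number of tableaux divided by the factorial of the size: a
  Vandermonde product over the factorials of the beta numbers.\<close>

definition frob :: "nat \<Rightarrow> (nat \<Rightarrow> nat) \<Rightarrow> real" where
  "frob a p = diff_prod a (\<lambda>i. real (shifted_part a p i)) / (\<Prod>i<a. fact (shifted_part a p i))"

lemma shifted_part_strict:
  assumes "antimono_on {..<a} p" "i < j" "j < a"
  shows "shifted_part a p j < shifted_part a p i"
proof -
  have "p j \<le> p i"
    using assms by (auto simp: monotone_on_def)
  then show ?thesis
    using assms(2,3) by (simp add: shifted_part_def)
qed

lemma inj_on_shifted_part:
  assumes "antimono_on {..<a} p"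
  shows "inj_on (shifted_part a p) {..<a}"
  by (rule linorder_inj_onI') (metis assms shifted_part_strict lessThan_iff less_irrefl)

lemma frob_nonzero:
  assumes "antimono_on {..<a} p"
  shows "frob a p \<noteq> 0"
  using shifted_part_strict[OF assms] by (force simp: frob_def diff_prod_def)

text \<open>Removing a cell from row \<open>t\<close> lowers its beta number by one: the Vandermonde
  product changes as in \<open>diff_prod_decrease\<close>, and the denominator loses the factor
  \<open>x t\<close>.\<close>

lemma frob_decrease:
  fixes a :: nat and p :: "nat \<Rightarrow> nat"
  defines "x \<equiv> \<lambda>i. real (shifted_part a p i)"
  assumes "antimono_on {..<a} p" "t < a" "p t > 0"
  shows "frob a (p(t := p t - 1)) = frob a p * (x t * (\<Prod>j\<in>{..<a} - {t}. 1 - 1 / (x t - x j)))"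
proof -
  have inj: "inj_on x {..<a}"
    using inj_on_shifted_part[OF assms(2)] by (auto simp: x_def inj_on_def)
  have pos: "shifted_part a p t > 0"
    using assms(4) by (simp add: shifted_part_def)
  have upd: "shifted_part a (p(t := p t - 1)) = (shifted_part a p)(t := shifted_part a p t - 1)"
    using assms(4) by (auto simp: shifted_part_def)
  have "(\<lambda>i. real (shifted_part a (p(t := p t - 1)) i)) = x(t := x t - 1)"
    unfolding upd using pos by (auto simp: x_def of_nat_diff)
  moreover have "(\<Prod>i<a. fact (shifted_part a p i)) =
      x t * (\<Prod>i<a. fact (shifted_part a (p(t := p t - 1)) i) :: real)"
  proof -
    have "(\<Prod>i\<in>{..<a} - {t}. fact (shifted_part a (p(t := p t - 1)) i)) =
        (\<Prod>i\<in>{..<a} - {t}. fact (shifted_part a p i) :: real)"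
      unfolding upd by (intro prod.cong) auto
    moreover have "fact (shifted_part a p t) = x t * fact (shifted_part a (p(t := p t - 1)) t)"
      unfolding upd using pos by (simp add: x_def fact_reduce)
    ultimately show ?thesis
      using assms(3) by (simp add: prod.remove[of "{..<a}" t])
  qed
  moreover have "x t \<noteq> 0" using pos by (simp add: x_def)
  ultimately show ?thesis
    using diff_prod_decrease[OF assms(3) inj]
    by (simp add: frob_def flip: x_def)
qed

section \<open>Corner cells and Frobenius' formula\<close>

definition removable :: "nat \<Rightarrow> (nat \<Rightarrow> nat) \<Rightarrow> nat set" where
  "removable a p = {i. i < a \<and> p i > 0 \<and> (Suc i < a \<longrightarrow> p (Suc i) < p i)}"

lemma maximal_in_shape:
  assumes "antimono_on {..<a} p"
  shows "maximal_in cell_less (shape a p) = (\<lambda>i. (i, p i - 1)) ` removable a p"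
proof (intro equalityI subsetI)
  fix c assume c: "c \<in> maximal_in cell_less (shape a p)"
  obtain i j where ij: "c = (i, j)" by fastforce
  have i: "i < a" "j < p i" and mx: "\<And>x. x \<in> shape a p \<Longrightarrow> \<not> cell_less (i, j) x"
    using c ij by (auto simp: maximal_in_def shape_def)
  have "\<not> Suc j < p i"
    using mx[of "(i, Suc j)"] i by (auto simp: shape_def cell_less_def)
  then have "j = p i - 1" using i by simp
  moreover have "\<not> (Suc i < a \<and> j < p (Suc i))"
    using mx[of "(Suc i, j)"] by (auto simp: shape_def cell_less_def)
  ultimately show "c \<in> (\<lambda>i. (i, p i - 1)) ` removable a p"
    using i ij by (auto simp: removable_def)
next
  fix c assume "c \<in> (\<lambda>i. (i, p i - 1)) ` removable a p"
  then obtain i where i: "c = (i, p i - 1)" "i < a" "p i > 0" "Suc i < a \<Longrightarrow> p (Suc i) < p i"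
    by (auto simp: removable_def)
  have "\<not> cell_less c (i', j')" if "i' < a" "j' < p i'" for i' j'
  proof
    assume "cell_less c (i', j')"
    then consider "i' = i" "j' > p i - 1" | "j' = p i - 1" "i < i'"
      using i(1) by (auto simp: cell_less_def)
    then show False
    proof cases
      case 2
      then have "p i' \<le> p (Suc i)"
        using assms that by (auto simp: monotone_on_def)
      then show False using 2 i that by simp
    qed (use that in simp)
  qed
  then show "c \<in> maximal_in cell_less (shape a p)"
    using i by (auto simp: maximal_in_def shape_def)
qed

lemma shape_diff_removable:
  assumes "t \<in> removable a p"
  shows "shape a p - {(t, p t - 1)} = shape a (p(t := p t - 1))"
  using assms by (auto simp: shape_def removable_def split: if_splits)

lemma antimono_on_removable:
  assumes "antimono_on {..<a} p" "t \<in> removable a p"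
  shows "antimono_on {..<a} (p(t := p t - 1))"
proof (rule monotone_onI)
  fix i j assume ij: "i \<in> {..<a}" "j \<in> {..<a}" "i \<le> j"
  then have le: "p j \<le> p i"
    using assms(1) by (auto simp: monotone_on_def)
  show "(p(t := p t - 1)) j \<le> (p(t := p t - 1)) i"
  proof (cases "i = t \<and> j \<noteq> t")
    case True
    then have "p j \<le> p (Suc t)" "p (Suc t) < p t"
      using assms ij by (auto simp: monotone_on_def removable_def)
    then show ?thesis using True by simp
  next
    case False
    then show ?thesis using le by auto
  qed
qed

text \<open>Frobenius' formula, up to the normalisation by the value at the empty partition.\<close>

lemma syt_shape:
  assumes "antimono_on {..<a} p"
  shows "real (syt (shape a p)) * frob a (\<lambda>_. 0) = fact (\<Sum>i<a. p i) * frob a p"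
  using assms
proof (induction "\<Sum>i<a. p i" arbitrary: p)
  case 0
  then have "shape a p = {}" "\<And>i. i < a \<Longrightarrow> p i = 0"
    by (auto simp: shape_def)
  moreover from this(2) have "frob a p = frob a (\<lambda>_. 0)"
    by (auto simp: frob_def diff_prod_def shifted_part_def intro!: arg_cong2[where f = "(/)"] prod.cong)
  ultimately show ?case by (simp flip: 0(1))
next
  case (Suc N)
  define x where "x i = real (shifted_part a p i)" for i
  define A where "A t = (\<Prod>j\<in>{..<a} - {t}. 1 - 1 / (x t - x j))" for t
  have inj: "inj_on x {..<a}"
    using inj_on_shifted_part[OF Suc.prems] by (auto simp: x_def inj_on_def)
  have ne: "shape a p \<noteq> {}"
    using Suc.hyps(2) card_shape[of a p] by auto
  have inj': "inj_on (\<lambda>i. (i, p i - 1)) (removable a p)"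
    by (auto simp: inj_on_def)
  have "syt (shape a p) = (\<Sum>t\<in>removable a p. syt (shape a p - {(t, p t - 1)}))"
    using Suc.prems ne inj'
    by (simp add: num_ext_remove_maximal[of "shape a p"] maximal_in_shape sum.reindex)
  also have "\<dots> = (\<Sum>t\<in>removable a p. syt (shape a (p(t := p t - 1))))"
    by (intro sum.cong refl arg_cong[where f = syt] shape_diff_removable)
  finally have "real (syt (shape a p)) * frob a (\<lambda>_. 0) =
      (\<Sum>t\<in>removable a p. real (syt (shape a (p(t := p t - 1)))) * frob a (\<lambda>_. 0))"
    by (simp add: sum_distrib_right)
  also have "\<dots> = (\<Sum>t\<in>removable a p. fact N * frob a p * (x t * A t))"
  proof (rule sum.cong)
    fix t assume t: "t \<in> removable a p"
    then have ta: "t < a" "p t > 0" by (auto simp: removable_def)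
    have "(\<Sum>i<a. p i) = p t + (\<Sum>i\<in>{..<a} - {t}. p i)"
      using ta by (simp add: sum.remove)
    moreover have "(\<Sum>i<a. (p(t := p t - 1)) i) = p t - 1 + (\<Sum>i\<in>{..<a} - {t}. p i)"
      using ta by (simp add: sum.remove)
    ultimately have N: "N = (\<Sum>i<a. (p(t := p t - 1)) i)"
      using Suc.hyps(2) ta by simp
    show "real (syt (shape a (p(t := p t - 1)))) * frob a (\<lambda>_. 0) = fact N * frob a p * (x t * A t)"
      by (simp only: Suc.hyps(1)[OF N antimono_on_removable[OF Suc.prems t]] N[symmetric]
          frob_decrease[OF Suc.prems ta] x_def A_def mult.assoc)
  qed simp
  \<comment> \<open>All rows may be included. If row \<open>t\<close> is not removable, either the
    next row has equal length and the factor of \<open>A t\<close> at \<open>Suc t\<close> vanishes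
    because \<open>x t - x (Suc t) = 1\<close>, or \<open>t\<close> is the last row and empty, so
    that \<open>x t = 0\<close>.\<close>
  also have "\<dots> = (\<Sum>t<a. fact N * frob a p * (x t * A t))"
  proof (rule sum.mono_neutral_left)
    show "\<forall>t\<in>{..<a} - removable a p. fact N * frob a p * (x t * A t) = 0"
    proof
      fix t assume t: "t \<in> {..<a} - removable a p"
      have "x t = 0 \<or> A t = 0"
      proof (cases "Suc t < a")
        case True
        then have "p (Suc t) \<le> p t"
          using Suc.prems by (auto simp: monotone_on_def)
        then have "p (Suc t) = p t"
          using t True by (auto simp: removable_def)
        then have "x t - x (Suc t) = 1"
          using True by (simp add: x_def shifted_part_def)
        then have "\<exists>j\<in>{..<a} - {t}. 1 - 1 / (x t - x j) = 0"
          using True by (intro bexI[of _ "Suc t"]) auto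
        then show ?thesis by (simp add: A_def prod_zero)
      next
        case False
        then show ?thesis
          using t by (auto simp: removable_def x_def shifted_part_def)
      qed
      then show "fact N * frob a p * (x t * A t) = 0" by auto
    qed
  qed (auto simp: removable_def)
  also have "\<dots> = fact N * frob a p * ((\<Sum>t<a. x t) - real (a choose 2))"
    using sum_prod_one_minus_inverse_diff[of "{..<a}" x] inj
    by (simp add: A_def sum_distrib_left[symmetric])
  \<comment> \<open>The staircase added in the beta numbers sums to \<open>a choose 2\<close>, so
    the difference is \<open>Suc N\<close>, which turns \<open>fact N\<close> into
    \<open>fact (Suc N)\<close>.\<close>
  also have "(\<Sum>t<a. x t) = real (Suc N) + real (a choose 2)"
  proof -
    have ch: "(\<Sum>t<a. a - 1 - t) = a choose 2"
      using sum.nat_diff_reindex[of "\<lambda>t. t" a] by (simp add: sum_lessThan_choose)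
    have "(\<Sum>t<a. shifted_part a p t) = Suc N + (a choose 2)"
      by (simp only: shifted_part_def sum.distrib ch Suc.hyps(2))
    then show ?thesis
      unfolding x_def by (simp only: of_nat_sum[symmetric] of_nat_add)
  qed
  finally show ?case by (simp flip: Suc.hyps(2))
qed

text \<open>Adding \<open>k\<close> to each part translates all beta numbers by \<open>k\<close>.
  The Vandermonde product is unchanged, so only factorials change, and the value at the empty
  partition cancels between two instances of \<open>syt_shape\<close>.\<close>

lemma syt_shape_add:
  assumes "antimono_on {..<a} p"
  shows "real (syt (shape a (\<lambda>i. k + p i))) =
    fact (k * a + (\<Sum>i<a. p i)) / fact (\<Sum>i<a. p i) *
    (\<Prod>i<a. fact (shifted_part a p i) / fact (shifted_part a p i + k)) * real (syt (shape a p))"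
proof -
  have mono: "antimono_on {..<a} (\<lambda>i. k + p i)"
    using assms by (auto simp: monotone_on_def)
  have sp: "shifted_part a (\<lambda>i. k + p i) i = shifted_part a p i + k" for i
    by (simp add: shifted_part_def)
  have "frob a (\<lambda>i. k + p i) =
      (\<Prod>i<a. fact (shifted_part a p i) / fact (shifted_part a p i + k)) * frob a p"
    by (simp add: frob_def sp diff_prod_def prod_dividef)
  then have "real (syt (shape a (\<lambda>i. k + p i))) * frob a (\<lambda>_. 0) =
      fact (k * a + (\<Sum>i<a. p i)) / fact (\<Sum>i<a. p i) *
      (\<Prod>i<a. fact (shifted_part a p i) / fact (shifted_part a p i + k)) *
      (real (syt (shape a p)) * frob a (\<lambda>_. 0))"
    unfolding syt_shape[OF assms] syt_shape[OF mono] by (simp add: sum.distrib mult.commute)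
  moreover have "frob a (\<lambda>_. 0) \<noteq> 0"
    by (rule frob_nonzero) (simp add: monotone_on_def)
  ultimately show ?thesis
    by (simp only: mult.assoc[symmetric] mult_right_cancel simp_thms)
qed

subsection \<open>Partitions in a box and their complements\<close>

abbreviation rect :: "nat \<Rightarrow> nat \<Rightarrow> (nat \<times> nat) set" where
  "rect a b \<equiv> {..<a} \<times> {..<b}"

definition row_len :: "(nat \<times> nat) set \<Rightarrow> nat \<Rightarrow> nat" where
  "row_len J i = card {j. (i, j) \<in> J}"

definition col_len :: "(nat \<times> nat) set \<Rightarrow> nat \<Rightarrow> nat" where
  "col_len J j = card {i. (i, j) \<in> J}"

lemma down_closed_eq_lessThan:
  fixes S :: "nat set"
  assumes "finite S" "\<And>i j. i \<in> S \<Longrightarrow> j < i \<Longrightarrow> j \<in> S"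
  shows "S = {..<card S}"
proof (cases "S = {}")
  case False
  have "S = {..Max S}"
  proof (intro equalityI subsetI)
    fix i assume "i \<in> {..Max S}"
    then consider "i = Max S" | "i < Max S"
      by fastforce
    then show "i \<in> S"
      using assms(2)[of "Max S" i] Max_in[OF assms(1) False] by cases simp_all
  qed (use assms(1) in simp)
  then have "card S = Suc (Max S)"
    by (metis card_atMost)
  then show ?thesis
    using \<open>S = {..Max S}\<close> by (simp add: lessThan_Suc_atMost)
qed simp

lemma mem_lower_iff_row_len:
  assumes "lower_in cell_less (rect a b) J"
  shows "(i, j) \<in> J \<longleftrightarrow> j < row_len J i"
proof -
  have "{j. (i, j) \<in> J} \<subseteq> {..<b}"
    using assms by (auto simp: lower_in_def)
  moreover have "j' \<in> {j. (i, j) \<in> J}" if "j \<in> {j. (i, j) \<in> J}" "j' < j" for j j'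
    using assms that by (force simp: lower_in_def cell_less_def)
  ultimately have "{j. (i, j) \<in> J} = {..<card {j. (i, j) \<in> J}}"
    by (intro down_closed_eq_lessThan) (auto intro: finite_subset)
  then show ?thesis
    by (auto simp: row_len_def)
qed

lemma mem_lower_iff_col_len:
  assumes "lower_in cell_less (rect a b) J"
  shows "(i, j) \<in> J \<longleftrightarrow> i < col_len J j"
proof -
  have "{i. (i, j) \<in> J} \<subseteq> {..<a}"
    using assms by (auto simp: lower_in_def)
  moreover have "i' \<in> {i. (i, j) \<in> J}" if "i \<in> {i. (i, j) \<in> J}" "i' < i" for i i'
    using assms that by (force simp: lower_in_def cell_less_def)
  ultimately have "{i. (i, j) \<in> J} = {..<card {i. (i, j) \<in> J}}"
    by (intro down_closed_eq_lessThan) (auto intro: finite_subset)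
  then show ?thesis
    by (auto simp: col_len_def)
qed

lemma row_len_le:
  assumes "lower_in cell_less (rect a b) J"
  shows "row_len J i \<le> b"
proof -
  have "{j. (i, j) \<in> J} \<subseteq> {..<b}"
    using assms by (auto simp: lower_in_def)
  then show ?thesis
    unfolding row_len_def by (metis card_lessThan card_mono finite_lessThan)
qed

lemma col_len_le:
  assumes "lower_in cell_less (rect a b) J"
  shows "col_len J j \<le> a"
proof -
  have "{i. (i, j) \<in> J} \<subseteq> {..<a}"
    using assms by (auto simp: lower_in_def)
  then show ?thesis
    unfolding col_len_def by (metis card_lessThan card_mono finite_lessThan)
qed

text \<open>If a lower row were longer, its cell in column \<open>row_len J i\<close> would lie in
  \<open>J\<close> while the cell above it in row \<open>i\<close> would not, although columns of
  \<open>J\<close> are initial segments.\<close>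

lemma antimono_row_len:
  assumes "lower_in cell_less (rect a b) J"
  shows "antimono (row_len J)"
proof (rule antimonoI)
  fix i i' :: nat assume "i \<le> i'"
  show "row_len J i' \<le> row_len J i"
  proof (rule ccontr)
    assume "\<not> row_len J i' \<le> row_len J i"
    then have "(i', row_len J i) \<in> J" "(i, row_len J i) \<notin> J"
      by (simp_all add: mem_lower_iff_row_len[OF assms])
    then show False
      using \<open>i \<le> i'\<close> by (simp add: mem_lower_iff_col_len[OF assms])
  qed
qed

lemma antimono_col_len:
  assumes "lower_in cell_less (rect a b) J"
  shows "antimono (col_len J)"
proof (rule antimonoI)
  fix j j' :: nat assume "j \<le> j'"
  show "col_len J j' \<le> col_len J j"
  proof (rule ccontr)
    assume "\<not> col_len J j' \<le> col_len J j"
    then have "(col_len J j, j') \<in> J" "(col_len J j, j) \<notin> J"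
      by (simp_all add: mem_lower_iff_col_len[OF assms])
    then show False
      using \<open>j \<le> j'\<close> by (simp add: mem_lower_iff_row_len[OF assms])
  qed
qed

lemma syt_swap: "finite D \<Longrightarrow> syt (prod.swap ` D) = syt D"
  by (rule num_ext_image) (auto simp: cell_less_def)

section \<open>Diagrams enlarged by \<open>k\<close> rows or \<open>k\<close> columns\<close>

definition shift_down :: "nat \<Rightarrow> nat \<times> nat \<Rightarrow> nat \<times> nat" where
  "shift_down k = (\<lambda>(i, j). (k + i, j))"

lemma inj_shift_down: "inj_on (shift_down k) A"
  by (auto simp: inj_on_def shift_down_def)

lemma mem_shift_down_image: "(i, j) \<in> shift_down k ` A \<longleftrightarrow> k \<le> i \<and> (i - k, j) \<in> A"
  by (force simp: shift_down_def image_iff)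

lemma syt_shift_down: "finite D \<Longrightarrow> syt (shift_down k ` D) = syt D"
  by (rule num_ext_image[OF _ inj_shift_down]) (auto simp: cell_less_def shift_down_def)

text \<open>The cells with entries smaller than the corner entry: \<open>k\<close> rows of length
  \<open>b\<close> above a copy of \<open>J\<close>.\<close>

definition lower_part :: "nat \<Rightarrow> nat \<Rightarrow> (nat \<times> nat) set \<Rightarrow> (nat \<times> nat) set" where
  "lower_part k b J = rect k b \<union> shift_down k ` J"

text \<open>Read by columns, the \<open>k\<close> extra rows add \<open>k\<close> to every part; the
  transposition brings the diagram into the form of \<open>syt_shape_add\<close>.\<close>

lemma lower_part_eq_shape:
  assumes "lower_in cell_less (rect a b) J"
  shows "lower_part k b J = prod.swap ` shape b (\<lambda>j. k + col_len J j)"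
proof -
  have J: "(i, j) \<in> J \<longleftrightarrow> j < b \<and> i < col_len J j" for i j
    using assms mem_lower_iff_col_len[OF assms] by (auto simp: lower_in_def)
  have "(i, j) \<in> lower_part k b J \<longleftrightarrow> (j, i) \<in> shape b (\<lambda>j. k + col_len J j)" for i j
    unfolding lower_part_def Un_iff mem_shift_down_image J shape_def by auto
  then show ?thesis
    by (simp add: set_eq_iff)
qed

lemma lower_part_0 [simp]: "lower_part 0 b J = J"
  by (simp add: lower_part_def set_eq_iff mem_shift_down_image)

lemma card_lower_eq_sum_col_len:
  assumes "lower_in cell_less (rect a b) J"
  shows "card J = (\<Sum>j<b. col_len J j)"
proof -
  have "J = prod.swap ` shape b (col_len J)"
    using lower_part_eq_shape[OF assms, of 0] by simp
  moreover have "card (prod.swap ` shape b (col_len J)) = card (shape b (col_len J))"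
    by (intro card_image inj_swap)
  ultimately have "card J = card (shape b (col_len J))"
    by (simp only:)
  then show ?thesis by (simp add: card_shape)
qed

lemma syt_lower_part:
  assumes "lower_in cell_less (rect a b) J"
  shows "syt (lower_part k b J) = syt (shape b (\<lambda>j. k + col_len J j))"
  unfolding lower_part_eq_shape[OF assms] by (simp add: syt_swap)

lemma syt_lower_part_ratio:
  assumes "lower_in cell_less (rect a b) J"
  shows "real (syt (lower_part k b J)) = fact (k * b + card J) / fact (card J) *
    (\<Prod>j<b. fact (shifted_part b (col_len J) j) / fact (shifted_part b (col_len J) j + k)) *
    real (syt J)"
proof -
  have "antimono_on {..<b} (col_len J)"
    using antimono_col_len[OF assms] by (auto simp: monotone_on_def)
  moreover have "syt J = syt (shape b (col_len J))"
    using syt_lower_part[OF assms, of 0] by simp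
  ultimately show ?thesis
    unfolding syt_lower_part[OF assms] card_lower_eq_sum_col_len[OF assms]
    by (simp only: syt_shape_add)
qed

text \<open>Row lengths of the complement of \<open>J\<close> in the box, read from the last row
  upwards, as they appear after a half turn.\<close>

definition complement_row_len :: "nat \<Rightarrow> nat \<Rightarrow> (nat \<times> nat) set \<Rightarrow> nat \<Rightarrow> nat" where
  "complement_row_len a b J i = b - row_len J (a - 1 - i)"

definition rotate_cell :: "nat \<Rightarrow> nat \<Rightarrow> nat \<times> nat \<Rightarrow> nat \<times> nat" where
  "rotate_cell a b = (\<lambda>(i, j). (a - 1 - i, b - 1 - j))"

text \<open>The cells outside \<open>J\<close> are right-justified; the half turn makes them
  left-justified, with \<open>k\<close> extra cells in every row.\<close>

lemma upper_part_eq_rotate: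
  assumes "lower_in cell_less (rect a b) J"
  shows "rect a (k + b) - J = rotate_cell a (k + b) ` shape a (\<lambda>i. k + complement_row_len a b J i)"
proof (intro equalityI subsetI)
  fix c assume c: "c \<in> rect a (k + b) - J"
  obtain i j where ij: "c = (i, j)" by fastforce
  then have *: "i < a" "j < k + b" "row_len J i \<le> j"
    using c mem_lower_iff_row_len[OF assms, of i j] by auto
  have "(a - 1 - i, k + b - 1 - j) \<in> shape a (\<lambda>i. k + complement_row_len a b J i)"
    using * row_len_le[OF assms, of i] by (auto simp: shape_def complement_row_len_def)
  moreover have "c = rotate_cell a (k + b) (a - 1 - i, k + b - 1 - j)"
    using * ij by (auto simp: rotate_cell_def)
  ultimately show "c \<in> rotate_cell a (k + b) ` shape a (\<lambda>i. k + complement_row_len a b J i)" by blast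
next
  fix c assume "c \<in> rotate_cell a (k + b) ` shape a (\<lambda>i. k + complement_row_len a b J i)"
  then obtain i j where ij: "c = (a - 1 - i, k + b - 1 - j)" "i < a" "j < k + (b - row_len J (a - 1 - i))"
    by (auto simp: shape_def complement_row_len_def rotate_cell_def)
  then have "\<not> k + b - 1 - j < row_len J (a - 1 - i)"
    using row_len_le[OF assms, of "a - 1 - i"] by linarith
  then show "c \<in> rect a (k + b) - J"
    using ij mem_lower_iff_row_len[OF assms] by auto
qed

lemma inj_on_rotate_cell: "inj_on (rotate_cell a (k + b)) (shape a (\<lambda>i. k + complement_row_len a b J i))"
  by (auto simp: inj_on_def rotate_cell_def shape_def complement_row_len_def)

text \<open>The half turn reverses \<open>cell_less\<close>, and reversing the relation preserves
  the number of labellings.\<close>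

lemma syt_upper_part:
  assumes "lower_in cell_less (rect a b) J"
  shows "syt (rect a (k + b) - J) = syt (shape a (\<lambda>i. k + complement_row_len a b J i))"
proof -
  let ?S = "shape a (\<lambda>i. k + complement_row_len a b J i)"
  have "syt (rotate_cell a (k + b) ` ?S) = num_ext (\<lambda>x y. cell_less y x) ?S"
    by (rule num_ext_image[OF finite_shape inj_on_rotate_cell])
      (auto simp: cell_less_def rotate_cell_def shape_def complement_row_len_def)
  then show ?thesis
    using num_ext_reverse[where R = cell_less and D = ?S, OF finite_shape cell_less_irrefl]
    by (simp only: upper_part_eq_rotate[OF assms])
qed

lemma syt_upper_part_ratio:
  assumes "lower_in cell_less (rect a b) J"
  shows "real (syt (rect a (k + b) - J)) =
    fact (k * a + (a * b - card J)) / fact (a * b - card J) *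
    (\<Prod>i<a. fact (shifted_part a (complement_row_len a b J) i) / fact (shifted_part a (complement_row_len a b J) i + k)) *
    real (syt (rect a b - J))"
proof -
  have "antimono_on {..<a} (complement_row_len a b J)"
    using antimono_row_len[OF assms]
    by (auto simp: monotone_on_def complement_row_len_def intro!: diff_le_mono2)
  \<comment> \<open>The instance \<open>k = 0\<close> of the half turn describes
    \<open>rect a b - J\<close> itself.\<close>
  moreover have "rect a b - J = rotate_cell a b ` shape a (complement_row_len a b J)"
      "inj_on (rotate_cell a b) (shape a (complement_row_len a b J))"
      "syt (rect a b - J) = syt (shape a (complement_row_len a b J))"
    using upper_part_eq_rotate[OF assms, of 0] inj_on_rotate_cell[of a 0 b J]
      syt_upper_part[OF assms, of 0] by simp_all
  moreover from this have "card (rect a b - J) = (\<Sum>i<a. complement_row_len a b J i)"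
    by (simp add: card_image card_shape)
  moreover have "card (rect a b - J) = a * b - card J"
    using assms by (subst card_Diff_subset) (auto simp: lower_in_def intro: finite_subset)
  ultimately show ?thesis
    unfolding syt_upper_part[OF assms] by (simp only: syt_shape_add)
qed

text \<open>Number the \<open>a + b\<close> steps of the boundary path of \<open>J\<close> from the
  top right to the bottom left corner of the box, starting at 0. The beta numbers of the columns are
  the numbers of the horizontal steps, those of the complement the numbers of the vertical
  steps.\<close>

lemma prod_shifted_parts:
  fixes g :: "nat \<Rightarrow> 'c::comm_monoid_mult"
  assumes "lower_in cell_less (rect a b) J"
  shows "(\<Prod>j<b. g (shifted_part b (col_len J) j)) * (\<Prod>i<a. g (shifted_part a (complement_row_len a b J) i)) =
    (\<Prod>s<a + b. g s)"
proof -
  let ?l = "shifted_part b (col_len J)"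
  \<comment> \<open>\<open>m i\<close> is the beta number of the complement at index
    \<open>a - 1 - i\<close>, which is the number of the vertical step in row
    \<open>i\<close>.\<close>
  define m where "m i = b - row_len J i + i" for i
  have m: "(\<Prod>i<a. g (shifted_part a (complement_row_len a b J) i)) = (\<Prod>i<a. g (m i))"
    by (rule prod.reindex_bij_witness[of _ "\<lambda>i. a - 1 - i" "\<lambda>i. a - 1 - i"])
      (auto simp: m_def shifted_part_def complement_row_len_def)
  have injl: "inj_on ?l {..<b}"
    using antimono_col_len[OF assms] by (intro inj_on_shifted_part) (auto simp: monotone_on_def)
  have injm: "inj_on m {..<a}"
  proof (rule linorder_inj_onI')
    fix i i' :: nat assume "i < i'"
    then have "row_len J i' \<le> row_len J i"
      using antimono_row_len[OF assms] by (simp add: monotone_on_def)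
    then show "m i \<noteq> m i'"
      using \<open>i < i'\<close> by (simp add: m_def)
  qed
  \<comment> \<open>If \<open>(i, j)\<close> lies in \<open>J\<close>, then \<open>m i\<close> is
    smaller than \<open>?l j\<close>; otherwise it is larger.\<close>
  have disj: "?l ` {..<b} \<inter> m ` {..<a} = {}"
  proof -
    have "?l j \<noteq> m i" if "j < b" "i < a" for i j
      using that row_len_le[OF assms, of i] col_len_le[OF assms, of j]
        mem_lower_iff_col_len[OF assms, of i j] mem_lower_iff_row_len[OF assms, of i j]
      unfolding shifted_part_def m_def by linarith
    then show ?thesis by auto
  qed
  have "?l ` {..<b} \<union> m ` {..<a} = {..<a + b}"
  proof (rule card_subset_eq)
    show "?l ` {..<b} \<union> m ` {..<a} \<subseteq> {..<a + b}"
    proof -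
      have "?l j < a + b" if "j < b" for j
        using that col_len_le[OF assms, of j] unfolding shifted_part_def by linarith
      moreover have "m i < a + b" if "i < a" for i
        using that unfolding m_def by linarith
      ultimately show ?thesis by auto
    qed
    show "card (?l ` {..<b} \<union> m ` {..<a}) = card {..<a + b}"
      using disj injl injm by (simp add: card_Un_disjoint card_image)
  qed simp
  then have "(\<Prod>s<a + b. g s) = (\<Prod>s\<in>?l ` {..<b}. g s) * (\<Prod>s\<in>m ` {..<a}. g s)"
    using disj by (simp flip: prod.union_disjoint)
  then show ?thesis
    unfolding m using injl injm by (simp add: prod.reindex)
qed

subsection \<open>Summation over the partitions in the box\<close>

abbreviation lower_sets :: "nat \<Rightarrow> nat \<Rightarrow> (nat \<times> nat) set set" where
  "lower_sets a b \<equiv> {J. lower_in cell_less (rect a b) J}"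

lemma finite_lower_sets: "finite (lower_sets a b)"
  using finite_lower_in[of "rect a b" cell_less "\<lambda>_. True"] by simp

lemma card_lower_le: "J \<in> lower_sets a b \<Longrightarrow> card J \<le> a * b"
  using card_mono[of "rect a b" J] by (auto simp: lower_in_def)

text \<open>Within each size \<open>r\<close> the weight is constant, and by
  \<open>num_ext_split\<close> the lower sets of that size account for every tableau of the
  rectangle once.\<close>

lemma sum_lower_sets_by_card:
  fixes g :: "nat \<Rightarrow> real"
  shows "(\<Sum>J\<in>lower_sets a b. g (card J) * (real (syt J) * real (syt (rect a b - J)))) =
    (\<Sum>r\<le>a * b. g r) * real (syt (rect a b))"
proof -
  have "(\<Sum>J\<in>lower_sets a b. g (card J) * (real (syt J) * real (syt (rect a b - J)))) =
      (\<Sum>r\<le>a * b. \<Sum>J | J \<in> lower_sets a b \<and> card J = r.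
        g (card J) * (real (syt J) * real (syt (rect a b - J))))"
    using card_lower_le by (intro sum.group[symmetric] finite_lower_sets) auto
  also have "\<dots> = (\<Sum>r\<le>a * b. g r * real (syt (rect a b)))"
  proof (rule sum.cong)
    fix r assume "r \<in> {..a * b}"
    then have "real (syt (rect a b)) =
        (\<Sum>J | J \<in> lower_sets a b \<and> card J = r. real (syt J) * real (syt (rect a b - J)))"
      using num_ext_split[of "rect a b" r cell_less] by simp
    then show "(\<Sum>J | J \<in> lower_sets a b \<and> card J = r.
        g (card J) * (real (syt J) * real (syt (rect a b - J)))) = g r * real (syt (rect a b))"
      by (simp add: sum_distrib_left)
  qed simp
  finally show ?thesis
    by (simp add: sum_distrib_right)
qed

text \<open>By \<open>prod_shifted_parts\<close> the products from the two parts combine to a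
  constant independent of \<open>J\<close>. The remaining weight depends only on
  \<open>card J\<close>, and its sum over the sizes is a binomial convolution.\<close>

lemma sum_lower_upper_parts:
  "(\<Sum>J\<in>lower_sets a b. real (syt (lower_part k b J)) * real (syt (rect a (k + b) - J))) =
    (\<Prod>s<a + b. fact s / fact (s + k)) * real (syt (rect a b)) * fact (k * b) * fact (k * a) *
    real ((k * b + k * a + a * b + 1) choose (a * b))"
proof -
  let ?C = "\<Prod>s<a + b. fact s / fact (s + k) :: real"
  define g :: "nat \<Rightarrow> real"
    where "g r = fact (k * b + r) / fact r * (fact (k * a + (a * b - r)) / fact (a * b - r))" for r
  have "(\<Sum>J\<in>lower_sets a b. real (syt (lower_part k b J)) * real (syt (rect a (k + b) - J))) =
      (\<Sum>J\<in>lower_sets a b. ?C * (g (card J) * (real (syt J) * real (syt (rect a b - J)))))"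
  proof (rule sum.cong)
    fix J assume "J \<in> lower_sets a b"
    then have J: "lower_in cell_less (rect a b) J" by simp
    show "real (syt (lower_part k b J)) * real (syt (rect a (k + b) - J)) =
        ?C * (g (card J) * (real (syt J) * real (syt (rect a b - J))))"
      unfolding syt_lower_part_ratio[OF J] syt_upper_part_ratio[OF J] g_def
        prod_shifted_parts[OF J, of "\<lambda>s. fact s / fact (s + k) :: real", symmetric]
      by (simp only: mult_ac)
  qed simp
  also have "\<dots> = ?C * ((\<Sum>r\<le>a * b. g r) * real (syt (rect a b)))"
    by (simp only: sum_distrib_left[symmetric] sum_lower_sets_by_card)
  \<comment> \<open>Each ratio of factorials is a binomial coefficient times
    \<open>fact (k * b)\<close> or \<open>fact (k * a)\<close>.\<close>
  also have "(\<Sum>r\<le>a * b. g r) = (\<Sum>r\<le>a * b. fact (k * b) * fact (k * a) *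
      real (((k * b + r) choose r) * ((k * a + (a * b - r)) choose (a * b - r))))"
    by (intro sum.cong) (simp_all add: g_def binomial_fact)
  also have "\<dots> = fact (k * b) * fact (k * a) * real ((k * b + k * a + a * b + 1) choose (a * b))"
    by (simp only: sum_distrib_left[symmetric] of_nat_sum[symmetric] sum_choose_mult_choose)
  finally show ?thesis
    by (simp only: mult_ac)
qed

text \<open>With \<open>a = m - k\<close> and \<open>b = n - k\<close>, \<open>D\<close> is the
  truncated diagram and \<open>(k - 1, b)\<close> its corner cell. The cells to the left of the
  corner, and hence those above them, must precede it, while a cell of \<open>I\<close> in column
  \<open>b\<close> or beyond would force the corner into \<open>I\<close>. What remains is a
  partition below the rectangle.\<close>

lemma pivot_lower_sets:
  fixes a b k :: nat
  assumes "k \<ge> 1"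
  defines "D \<equiv> {(i, j). i < a + k \<and> j < (if i < k - 1 then b else if i = k - 1 then b + 1 else b + k)}"
  shows "{I. lower_in cell_less D I \<and> (k - 1, b) \<notin> I \<and> lower_in cell_less D (insert (k - 1, b) I)} =
      lower_part k b ` lower_sets a b"
proof (intro equalityI subsetI)
  fix I assume "I \<in> {I. lower_in cell_less D I \<and> (k - 1, b) \<notin> I \<and> lower_in cell_less D (insert (k - 1, b) I)}"
  then have low: "lower_in cell_less D I" and nc: "(k - 1, b) \<notin> I"
    and lowc: "lower_in cell_less D (insert (k - 1, b) I)" by auto
  have ID: "I \<subseteq> D" using low by (simp add: lower_in_def)
  have down: "y \<in> I" if "x \<in> I" "y \<in> D" "cell_less y x" for x y
    using low that unfolding lower_in_def by blast
  have top: "(i, j) \<in> I" if "i < k" "j < b" for i j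
  proof -
    have in_D: "(k - 1, j) \<in> D" "(i, j) \<in> D"
      using that assms(1) by (auto simp: D_def)
    then have "(k - 1, j) \<in> I"
      using lowc that unfolding lower_in_def by (auto simp: cell_less_def)
    then show ?thesis
      using down[of "(k - 1, j)" "(i, j)"] in_D that by (cases "i = k - 1") (auto simp: cell_less_def)
  qed
  have left: "j < b" if "(i, j) \<in> I" for i j
  proof (rule ccontr)
    assume "\<not> j < b"
    have "(i, j) \<in> D" using that ID by blast
    \<comment> \<open>Only the rows from \<open>k - 1\<close> on reach column \<open>b\<close>;
      going left to column \<open>b\<close> and then up leads to the corner.\<close>
    then have i: "i \<ge> k - 1" and "(i, b) \<in> D" "(k - 1, b) \<in> D"
      using \<open>\<not> j < b\<close> assms(1) by (auto simp: D_def split: if_splits)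
    then have "(i, b) \<in> I"
      using down[OF that, of "(i, b)"] that \<open>\<not> j < b\<close> by (cases "j = b") (auto simp: cell_less_def)
    then have "(k - 1, b) \<in> I"
      using down[of "(i, b)" "(k - 1, b)"] i \<open>(k - 1, b) \<in> D\<close>
      by (cases "i = k - 1") (auto simp: cell_less_def)
    then show False using nc by simp
  qed
  define J where "J = {(i, j). (k + i, j) \<in> I}"
  have "lower_in cell_less (rect a b) J"
    unfolding lower_in_def
  proof (intro conjI ballI impI)
    show "J \<subseteq> rect a b"
      using ID left by (auto simp: J_def D_def)
  next
    fix x y assume x: "x \<in> J" and y: "y \<in> rect a b" and less: "cell_less y x"
    have "(k + fst y, snd y) \<in> D"
      using y assms(1) by (auto simp: D_def)
    then show "y \<in> J"
      using down[of "(k + fst x, snd x)" "(k + fst y, snd y)"] x less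
      by (auto simp: J_def cell_less_def)
  qed
  moreover have "I = lower_part k b J"
  proof -
    have "(i, j) \<in> I \<longleftrightarrow> (i, j) \<in> lower_part k b J" for i j
      using top[of i j] left[of i j]
      by (cases "i < k") (auto simp: lower_part_def mem_shift_down_image J_def)
    then show ?thesis by (simp add: set_eq_iff)
  qed
  ultimately show "I \<in> lower_part k b ` lower_sets a b" by blast
next
  fix I assume "I \<in> lower_part k b ` lower_sets a b"
  then obtain J where I: "I = lower_part k b J" and J: "J \<subseteq> rect a b"
    and down: "\<And>x y. x \<in> J \<Longrightarrow> y \<in> rect a b \<Longrightarrow> cell_less y x \<Longrightarrow> y \<in> J"
    by (auto simp: lower_in_def)
  have mem: "(i, j) \<in> I \<longleftrightarrow> j < b \<and> (i < k \<or> (i - k, j) \<in> J)" for i j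
    using J by (auto simp: I lower_part_def mem_shift_down_image)
  have sub: "I \<subseteq> D"
  proof (rule subrelI)
    fix i j assume "(i, j) \<in> I"
    then have "j < b" "i < a + k"
      using J by (auto simp: mem)
    then show "(i, j) \<in> D"
      by (simp add: D_def)
  qed
  have "(k - 1, b) \<in> D" "(k - 1, b) \<notin> I"
    using assms(1) by (auto simp: D_def mem)
  moreover have "y \<in> I" if "x \<in> insert (k - 1, b) I" "y \<in> D" "cell_less y x" for x y
  proof -
    obtain i j i' j' where xy: "x = (i, j)" "y = (i', j')" by fastforce
    \<comment> \<open>The predecessors of the corner in \<open>D\<close> lie to its left, because
      the rows above it have only length \<open>b\<close>.\<close>
    have b: "j' < b"
      using that xy assms(1) by (auto simp: mem D_def cell_less_def split: if_splits)
    show ?thesis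
    proof (cases "i' < k")
      case False
      then have "i' \<le> i" "i \<ge> k"
        using that(3) xy by (auto simp: cell_less_def)
      then have "(i - k, j) \<in> J"
        using that(1) xy assms(1) by (auto simp: mem)
      moreover have "(i' - k, j') \<in> rect a b"
        using False b that(2) xy by (auto simp: D_def)
      moreover have "cell_less (i' - k, j') (i - k, j)"
        using False that(3) xy \<open>i \<ge> k\<close> by (auto simp: cell_less_def)
      ultimately show ?thesis
        using down b by (auto simp: xy mem)
    qed (use b in \<open>simp add: mem xy\<close>)
  qed
  ultimately show "I \<in> {I. lower_in cell_less D I \<and> (k - 1, b) \<notin> I \<and> lower_in cell_less D (insert (k - 1, b) I)}"
    using sub unfolding lower_in_def by blast
qed

text \<open>This is \<open>num_ext_pivot\<close> at the corner cell
  \<open>(k - 1, b)\<close>.\<close>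

lemma syt_truncated:
  fixes a b k :: nat
  assumes "k \<ge> 1"
  defines "D \<equiv> {(i, j). i < a + k \<and> j < (if i < k - 1 then b else if i = k - 1 then b + 1 else b + k)}"
  shows "syt D = (\<Sum>J\<in>lower_sets a b. syt (lower_part k b J) * syt (rect a (k + b) - J))"
proof -
  have fin: "finite D"
    by (rule finite_subset[of _ "rect (a + k) (b + k)"])
      (use assms(1) in \<open>auto simp: D_def split: if_splits\<close>)
  \<comment> \<open>\<open>J\<close> is recovered from \<open>lower_part k b J\<close> by cutting
    off the first \<open>k\<close> rows.\<close>
  have inj: "inj_on (lower_part k b) (lower_sets a b)"
  proof (rule inj_onI)
    fix J J' assume eq: "lower_part k b J = lower_part k b J'"
    have "J = {(i, j). (k + i, j) \<in> lower_part k b J}" for J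
      by (auto simp: lower_part_def mem_shift_down_image)
    then show "J = J'"
      using eq by metis
  qed
  have upper: "syt (D - insert (k - 1, b) (lower_part k b J)) = syt (rect a (k + b) - J)"
    if "J \<in> lower_sets a b" for J
  proof -
    have J: "(i, j) \<in> J \<Longrightarrow> j < b" for i j
      using that by (auto simp: lower_in_def)
    \<comment> \<open>In the first \<open>k\<close> rows of \<open>D\<close>, only the corner lies
      outside the \<open>k\<close> by \<open>b\<close> rectangle, so the remainder occupies the last
      \<open>a\<close> rows.\<close>
    have "(i, j) \<in> D - insert (k - 1, b) (lower_part k b J) \<longleftrightarrow>
        (i, j) \<in> shift_down k ` (rect a (k + b) - J)" for i j
      using assms(1) J by (auto simp: D_def lower_part_def mem_shift_down_image split: if_splits)
    then have "D - insert (k - 1, b) (lower_part k b J) = shift_down k ` (rect a (k + b) - J)"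
      by (simp only: set_eq_iff split_paired_All simp_thms)
    then show ?thesis by (simp add: syt_shift_down)
  qed
  have "(k - 1, b) \<in> D"
    using assms(1) by (auto simp: D_def)
  then have "syt D = (\<Sum>I\<in>lower_part k b ` lower_sets a b. syt I * syt (D - insert (k - 1, b) I))"
    using fin num_ext_pivot[of D "(k - 1, b)" cell_less] pivot_lower_sets[OF assms(1), of a b]
    by (simp add: cell_less_irrefl D_def)
  then show ?thesis
    using inj by (simp add: sum.reindex upper del: One_nat_def)
qed

section \<open>Rectangular shapes and the closed formula\<close>

lemma prod_lessThan_add:
  fixes g :: "nat \<Rightarrow> 'c::comm_monoid_mult"
  shows "(\<Prod>s<a + b. g s) = (\<Prod>i<a. g i) * (\<Prod>j<b. g (a + j))"
  by (induction b) (simp_all add: mult_ac)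

text \<open>The constant partition has beta numbers \<open>a, ..., a + b - 1\<close>, so
  \<open>syt_shape_add\<close> becomes explicit.\<close>

lemma syt_rect_add:
  "real (syt (rect b (k + a))) = fact (k * b + a * b) / fact (a * b) *
    (\<Prod>j<b. fact (a + j) / fact (a + j + k)) * real (syt (rect b a))"
proof -
  have rect: "rect b c = shape b (\<lambda>_. c)" for c
    by (auto simp: shape_def)
  have "antimono_on {..<b} (\<lambda>_. a)" by (simp add: monotone_on_def)
  moreover have "(\<Prod>j<b. fact (shifted_part b (\<lambda>_. a) j) / fact (shifted_part b (\<lambda>_. a) j + k) :: real) =
      (\<Prod>j<b. fact (a + j) / fact (a + j + k))"
    by (rule prod.reindex_bij_witness[of _ "\<lambda>i. b - 1 - i" "\<lambda>i. b - 1 - i"])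
      (auto simp: shifted_part_def)
  ultimately show ?thesis
    using syt_shape_add[of b "\<lambda>_. a" k] by (simp add: rect mult.commute)
qed

lemma syt_rect_commute: "syt (rect a b) = syt (rect b a)"
  using syt_swap[of "rect a b"] by (simp add: product_swap)

lemma diagram_replicate: "diagram (replicate r c) = rect r c"
  by (auto simp: diagram_def part_def split: if_splits)

text \<open>Turns the binomial coefficient of the convolution into the two of the closed formula,
  for \<open>x = k * b\<close>, \<open>y = k * a\<close> and \<open>z = a * b\<close>. In terms of
  factorials, those of \<open>x + z\<close> and \<open>y + 1\<close> cancel on the right.\<close>

lemma fact_mult_choose:
  "fact x * real ((x + y + z + 1) choose z) =
    real ((x + y + z + 1) choose (x + z)) * inverse (real ((x + y + 1) choose x)) *
    (fact (x + z) / fact z)"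
proof -
  have "real ((x + y + z + 1) choose z) = fact (x + y + z + 1) / (fact z * fact (x + y + 1))"
    using binomial_fact[of z "x + y + z + 1"] by (simp del: fact_Suc)
  moreover have "real ((x + y + z + 1) choose (x + z)) =
      fact (x + y + z + 1) / (fact (x + z) * fact (y + 1))"
    using binomial_fact[of "x + z" "x + y + z + 1"] by (simp del: fact_Suc)
  moreover have "real ((x + y + 1) choose x) = fact (x + y + 1) / (fact x * fact (y + 1))"
    using binomial_fact[of x "x + y + 1"] by (simp del: fact_Suc)
  ultimately show ?thesis
    by (simp add: mult.commute del: fact_Suc)
qed

theorem theorem3:
  fixes n m k :: nat
  assumes "1 \<le> n" "1 \<le> m" "1 \<le> k" "k \<le> n" "k \<le> m"
  shows "real (num_truncated_SYT (replicate m n) (replicate (k - 1) k @ [k - 1])) =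
    real ((n * m - k\<^sup>2 + 1) choose (m * (n - k))) *
    inverse (real ((k * (m + n - 2 * k) + 1) choose (k * n - k\<^sup>2))) *
    real (num_SYT (replicate (n - k) m)) * real (num_SYT (replicate k (m - k)))"
proof -
  obtain a b where ab: "m = a + k" "n = b + k"
    using assms by (metis le_add_diff_inverse2)
  \<comment> \<open>The constant of the summation is \<open>P 0 (a + b)\<close>; its segments
    \<open>P 0 a\<close> and \<open>P a b\<close> are absorbed by the two rectangles of the
    formula.\<close>
  define P where "P c d = (\<Prod>j<d. fact (c + j) / fact (c + j + k) :: real)" for c d
  have arith: "n * m - k\<^sup>2 + 1 = k * b + k * a + a * b + 1" "m * b = k * b + a * b"
      "k * (m + n - 2 * k) + 1 = k * b + k * a + 1" "k * n - k\<^sup>2 = k * b" "n - k = b" "m - k = a"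
    by (simp_all add: ab power2_eq_square algebra_simps)
  have trunc: "real (num_truncated_SYT (replicate m n) (replicate (k - 1) k @ [k - 1])) =
      P 0 (a + b) * real (syt (rect a b)) * fact (k * b) * fact (k * a) *
      real ((k * b + k * a + a * b + 1) choose (a * b))"
    unfolding num_truncated_SYT_def card_standard_tableaux
      truncated_diagram_square_minus_box[OF assms(3-5), unfolded arith(5)]
    unfolding ab
    using syt_truncated[OF assms(3), of a b] sum_lower_upper_parts[of k b a]
    by (simp add: P_def)
  have f1: "real (num_SYT (replicate b m)) =
      fact (k * b + a * b) / fact (a * b) * P a b * real (syt (rect a b))"
    using syt_rect_add[of b k a]
    by (simp add: num_SYT_def card_standard_tableaux diagram_replicate ab P_def add.commute
        syt_rect_commute[of b a])
  \<comment> \<open>Here the rectangle grows from zero columns, and the empty diagram contributes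
    the factor 1.\<close>
  have f2: "real (num_SYT (replicate k a)) = fact (k * a) * P 0 a"
    using syt_rect_add[of a k 0]
    by (simp add: num_SYT_def card_standard_tableaux diagram_replicate P_def syt_rect_commute[of k a])
  have PP: "P 0 (a + b) = P 0 a * P a b"
    by (simp add: P_def prod_lessThan_add)
  have regroup: "P 0 a * P a b * real (syt (rect a b)) * fact (k * b) * fact (k * a) * x =
      P 0 a * P a b * real (syt (rect a b)) * fact (k * a) * (fact (k * b) * x)" for x
    by (simp only: mult_ac)
  show ?thesis
    unfolding trunc arith f1 f2 PP regroup fact_mult_choose[of "k * b" "k * a" "a * b"]
    by (simp only: mult_ac)
qed

end
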